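(* Let $a,b,c,\omega,h,r>0$ be real numbers and consider the autonomous system on $\mathbb{R}^3$ $$\begin{aligned} \dot{x}_1 &= (x_3^2-h^2)x_1-\omega x_2,\\ \dot{x}_2 &= \omega x_1+(x_3^2-h^2)x_2,\\ \dot{x}_3 &= (r^2-a x_1^2-b x_2^2-c x_3^2)\,x_3 . \end{aligned}$$ Then every trajectory of this system is bounded in the forward time direction: for every initial condition $(x_1(0),x_2(0),x_3(0))\in\mathbb{R}^3$ there is a constant $M<\infty$ (depending on the initial condition) such that the solution satisfies $\|(x_1(t),x_2(t),x_3(t))\|\le M$ for all $t\ge 0$ for which it is defined.
   Context: Here $\dot{x}_i$ denotes the derivative of $x_i$ with respect to time $t$, and $\|\cdot\|$ is the Euclidean norm on $\mathbb{R}^3$. *)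

theory Defs
  imports "HOL-Analysis.Analysis"
begin

definition system_field ::
  "real \<Rightarrow> real \<Rightarrow> real \<Rightarrow> real \<Rightarrow> real \<Rightarrow> real \<Rightarrow> real^3 \<Rightarrow> real^3"
  where
  "system_field a b c \<omega> h r x = vector
     [(x$3 ^ 2 - h ^ 2) * x$1 - \<omega> * x$2,
      \<omega> * x$1 + (x$3 ^ 2 - h ^ 2) * x$2,
      (r ^ 2 - a * x$1 ^ 2 - b * x$2 ^ 2 - c * x$3 ^ 2) * x$3]"

text \<open>The domain \<open>J\<close> is any interval containing the initial time 0: open, closed or
  half-open, bounded or not, and not necessarily maximal. At an endpoint belonging to \<open>J\<close>,
  the derivative is one-sided.\<close>

definition is_solution_on :: "(real^3 \<Rightarrow> real^3) \<Rightarrow> real^3 \<Rightarrow> real set \<Rightarrow> (real \<Rightarrow> real^3) \<Rightarrow> bool"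
  where
  "is_solution_on F x0 J x \<longleftrightarrow>
     is_interval J \<and> 0 \<in> J \<and> x 0 = x0 \<and>
     (\<forall>t\<in>J. (x has_vector_derivative F (x t)) (at t within J))"

end

theory Submission
  imports Defs
begin

text \<open>
  The equations are of predator-prey type in \<open>V = x\<^sub>1\<^sup>2 + x\<^sub>2\<^sup>2\<close> and \<open>W = x\<^sub>3\<^sup>2\<close>: the rotation
  by \<open>\<omega>\<close> drops out of \<open>V' = 2 (W - h\<^sup>2) V\<close>, and with \<open>m = min a b\<close> one has
  \<open>W' \<le> 2 (r\<^sup>2 - m V - c W) W\<close>. In the energy \<open>L = m V + W\<close> the growth term \<open>2 m V W\<close> of the
  first equation is cancelled by the second, which leaves
  \<open>L' \<le> - 2 h\<^sup>2 m V + 2 r\<^sup>2 W - 2 c W\<^sup>2 = - 2 h\<^sup>2 L + 2 (r\<^sup>2 + h\<^sup>2) W - 2 c W\<^sup>2\<close>.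
  The last two terms form a concave quadratic in \<open>W\<close> with maximum \<open>(r\<^sup>2 + h\<^sup>2)\<^sup>2 / (2 c)\<close>. So \<open>L\<close>
  satisfies a linear dissipative differential inequality (\<open>energy_dissipation\<close>), hence it stays
  bounded in forward time (\<open>dissipative_bound\<close>), and so does the norm because \<open>m > 0\<close>.
  The bound depends on the initial point alone, not on the solution or on its domain.
\<close>

text \<open>Since \<open>f' + B f \<le> A\<close>, the function \<open>(f - A / B) exp (B s)\<close> is non-increasing.\<close>

lemma dissipative_bound:
  fixes f f' :: "real \<Rightarrow> real"
  assumes "B > 0" and "0 \<le> t"
    and deriv: "\<And>s. s \<in> {0..t} \<Longrightarrow> (f has_real_derivative f' s) (at s within {0..t})"
    and ineq: "\<And>s. s \<in> {0..t} \<Longrightarrow> f' s \<le> A - B * f s"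
  shows "f t \<le> max (f 0) (A / B)"
proof (cases "t = 0")
  case False
  with \<open>0 \<le> t\<close> have "0 < t" by simp
  define g where "g s = (f s - A / B) * exp (B * s)" for s
  have g_deriv: "(g has_real_derivative (f' s + B * f s - A) * exp (B * s)) (at s within {0..t})"
    if "s \<in> {0..t}" for s
    unfolding g_def using \<open>B > 0\<close>
    by (auto intro!: derivative_eq_intros deriv[OF that] simp: field_simps)
  have "g t \<le> g 0"
  proof (rule DERIV_nonpos_imp_decreasing_open[OF \<open>0 \<le> t\<close>])
    fix s assume s: "0 < s" "s < t"
    then have "(g has_real_derivative (f' s + B * f s - A) * exp (B * s)) (at s)"
      using g_deriv[of s] at_within_Icc_at[of 0 s t] by simp
    moreover have "(f' s + B * f s - A) * exp (B * s) \<le> 0"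
      using ineq[of s] s by (intro mult_nonpos_nonneg) auto
    ultimately show "\<exists>y. DERIV g s :> y \<and> y \<le> 0" by blast
  next
    show "continuous_on {0..t} g"
      using g_deriv by (rule DERIV_continuous_on)
  qed
  then have le: "(f t - A / B) * exp (B * t) \<le> f 0 - A / B"
    by (simp add: g_def)
  show ?thesis
  proof (cases "f t \<le> A / B")
    case False
    have "1 \<le> exp (B * t)" using \<open>B > 0\<close> \<open>0 \<le> t\<close> by simp
    then have "(f t - A / B) * 1 \<le> (f t - A / B) * exp (B * t)"
      using False by (intro mult_left_mono) auto
    with le show ?thesis by simp
  qed simp
qed simp

lemma energy_dissipation:
  fixes a b c h r m x y z :: real
  assumes "c > 0" and "m \<le> a" and "m \<le> b"
  shows "2 * m * (z\<^sup>2 - h\<^sup>2) * (x\<^sup>2 + y\<^sup>2) + 2 * (r\<^sup>2 - a * x\<^sup>2 - b * y\<^sup>2 - c * z\<^sup>2) * z\<^sup>2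
    \<le> (r\<^sup>2 + h\<^sup>2)\<^sup>2 / (2 * c) - 2 * h\<^sup>2 * (m * (x\<^sup>2 + y\<^sup>2) + z\<^sup>2)"
proof -
  \<comment> \<open>The difference of the two sides is a sum of these three non-negative terms.\<close>
  have "0 \<le> 2 * (a - m) * x\<^sup>2 * z\<^sup>2" "0 \<le> 2 * (b - m) * y\<^sup>2 * z\<^sup>2"
    using assms by auto
  moreover have "0 \<le> 2 * c * (z\<^sup>2 - (r\<^sup>2 + h\<^sup>2) / (2 * c))\<^sup>2"
    using assms by simp
  moreover have "2 * c * (z\<^sup>2 - (r\<^sup>2 + h\<^sup>2) / (2 * c))\<^sup>2
      = 2 * c * z\<^sup>2 * z\<^sup>2 - 2 * (r\<^sup>2 + h\<^sup>2) * z\<^sup>2 + (r\<^sup>2 + h\<^sup>2)\<^sup>2 / (2 * c)"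
    using assms by (simp add: power2_eq_square field_simps)
  ultimately show ?thesis by (simp add: algebra_simps)
qed

lemma has_real_derivative_vec_nth:
  assumes "(x has_vector_derivative v) (at t within S)"
  shows "((\<lambda>s. x s $ i) has_real_derivative v $ i) (at t within S)"
  using bounded_linear.has_vector_derivative[OF bounded_linear_vec_nth assms]
  by (simp add: has_real_derivative_iff_has_vector_derivative)

theorem mainTheorem1:
  fixes a b c \<omega> h r :: real
  assumes "a > 0" and "b > 0" and "c > 0" and "\<omega> > 0" and "h > 0" and "r > 0"
  shows "\<forall>x0 :: real^3. \<exists>M :: real. \<forall>J x.
    is_solution_on (system_field a b c \<omega> h r) x0 J x \<longrightarrow>
    (\<forall>t\<in>J. t \<ge> 0 \<longrightarrow> norm (x t) \<le> M)"
proof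
  fix x0 :: "real^3"
  define m where "m = min a b"
  have m: "m > 0" "m \<le> a" "m \<le> b" using assms by (auto simp: m_def)
  define L where "L v = m * ((v$1)\<^sup>2 + (v$2)\<^sup>2) + (v$3)\<^sup>2" for v :: "real^3"
  define A where "A = (r\<^sup>2 + h\<^sup>2)\<^sup>2 / (2 * c)"
  define E where "E = max (L x0) (A / (2 * h\<^sup>2))"
  have "norm (x t) \<le> sqrt (E / m + E)"
    if sol: "is_solution_on (system_field a b c \<omega> h r) x0 J x" and t: "t \<in> J" "0 \<le> t"
    for J x t
  proof -
    have sub: "{0..t} \<subseteq> J"
      using sol t by (auto simp: is_solution_on_def is_interval_1)
    define L' where "L' s = 2 * m * ((x s$3)\<^sup>2 - h\<^sup>2) * ((x s$1)\<^sup>2 + (x s$2)\<^sup>2)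
      + 2 * (r\<^sup>2 - a * (x s$1)\<^sup>2 - b * (x s$2)\<^sup>2 - c * (x s$3)\<^sup>2) * (x s$3)\<^sup>2" for s
    have "L (x t) \<le> max (L (x 0)) (A / (2 * h\<^sup>2))"
    proof (rule dissipative_bound[where f = "\<lambda>s. L (x s)" and f' = L'])
      fix s assume s: "s \<in> {0..t}"
      have "(x has_vector_derivative system_field a b c \<omega> h r (x s)) (at s within {0..t})"
        using sol sub s has_vector_derivative_within_subset unfolding is_solution_on_def by blast
      note d = has_real_derivative_vec_nth[OF this]
      show "((\<lambda>s. L (x s)) has_real_derivative L' s) (at s within {0..t})"
        unfolding L_def L'_def
        by (auto intro!: derivative_eq_intros d
            simp: system_field_def power2_eq_square algebra_simps)
      show "L' s \<le> A - 2 * h\<^sup>2 * L (x s)"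
        unfolding L'_def A_def L_def by (rule energy_dissipation[OF \<open>c > 0\<close> m(2,3)])
    qed (use \<open>h > 0\<close> t in auto)
    then have LE: "L (x t) \<le> E"
      using sol by (simp add: E_def is_solution_on_def)
    have "m * ((x t$1)\<^sup>2 + (x t$2)\<^sup>2) \<le> E"
      using LE zero_le_power2[of "x t$3"] unfolding L_def by linarith
    then have "(x t$1)\<^sup>2 + (x t$2)\<^sup>2 \<le> E / m"
      using m(1) by (simp add: pos_le_divide_eq mult.commute)
    moreover have "0 \<le> m * ((x t$1)\<^sup>2 + (x t$2)\<^sup>2)" using m(1) by simp
    then have "(x t$3)\<^sup>2 \<le> E"
      using LE unfolding L_def by linarith
    ultimately show ?thesis
      by (simp add: norm_vec_def L2_set_def sum_3)
  qed
  then show "\<exists>M. \<forall>J x. is_solution_on (system_field a b c \<omega> h r) x0 J x \<longrightarrow>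
      (\<forall>t\<in>J. t \<ge> 0 \<longrightarrow> norm (x t) \<le> M)"
    by blast
qed

end
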